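(* Write $[a,b,c,d]$ for the point $(a+b\sqrt2,\;c+d\sqrt2)\in\mathbf{R}^2$, where $a,b,c,d$ are integers, and for a point $\mathbf{p}\in\mathbf{R}^2$ let $\langle \mathbf{p}\rangle$ be its octagonal orbit, i.e. the set of images of $\mathbf{p}$ under the rotations about the origin by the angles $k\pi/4$, $k=0,1,\dots,7$. Let $W_{80}$ be the set of $80$ vectors $$W_{80}=\langle \mathbf{a}_1\rangle\cup\langle \mathbf{b}_1\rangle\cup\langle \mathbf{c}_1\rangle\cup\langle \mathbf{d}_1\rangle\cup\langle \mathbf{e}_1\rangle\cup\langle \mathbf{f}_1\rangle\cup\langle \mathbf{g}_1\rangle\cup\langle \mathbf{h}_1\rangle\cup\langle \mathbf{i}_1\rangle\cup\langle \mathbf{j}_1\rangle,$$ where $\mathbf{a}_1=[4,0,0,0]$, $\mathbf{b}_1=[2,1,0,1]$, $\mathbf{c}_1=[-2,4,-2,2]$, $\mathbf{d}_1=[6,-2,2,0]$, $\mathbf{e}_1=[12,-6,4,-2]$, $\mathbf{f}_1=[-8,8,-4,4]$, $\mathbf{g}_1=[-6,7,-4,3]$, $\mathbf{h}_1=[10,-5,4,-1]$, $\mathbf{i}_1=[8,-3,2,-1]$, $\mathbf{j}_1=[-4,5,-2,3]$. Let $S$ be the set of the following $15$ points: $[-4,4,0,0]$, $[-4,5,2,-1]$, $[-2,2,6,-4]$, $[-2,3,-4,3]$, $[-2,4,-2,2]$, $[0,1,2,-1]$, $[0,2,4,-2]$, $[2,-1,-4,3]$, $[2,0,-2,2]$,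 $[2,1,0,1]$, $[2,2,2,0]$, $[4,0,-4,4]$, $[4,0,0,0]$, $[6,-2,2,0]$, $[6,-1,0,1]$. Let $G_{120}$ be the graph with vertex set $\bigcup_{\mathbf{s}\in S}\langle \mathbf{s}\rangle$ in which two vertices $\mathbf{u},\mathbf{v}$ are adjacent if and only if $\mathbf{u}-\mathbf{v}\in W_{80}$. Then $G_{120}$ has $120$ vertices and $704$ edges, and its chromatic number is $5$. Hence $\chi(\mathbf{R}^2,C)\ge 5$ when $C$ is a regular octagon centered at the origin.
   Context: For a closed convex curve $C\subset\mathbf{R}^2$ symmetric with respect to the origin, $(\mathbf{R}^2,C)$ denotes the Minkowski plane with unit circle $C$: two points $\mathbf{x},\mathbf{y}\in\mathbf{R}^2$ are at Minkowski distance $1$ if $\mathbf{x}-\mathbf{y}\in C$. The chromatic number $\chi(\mathbf{R}^2,C)$ is the least number of colors needed to color all points of $\mathbf{R}^2$ so that no two points at Minkowski distance $1$ receive the same color. A regular octagon here means the boundary curve of the polygon. The octagon used for the coordinates is the one with vertex set $\langle\mathbf{a}_1\rangle$, i.e. $(\pm4,0)$, $(0,\pm4)$, $(\pm2\sqrt2,\pm2\sqrt2)$; all vectors of $W_{80}$ lie on it. *)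

theory Defs
  imports "HOL-Analysis.Analysis" "HOL-Library.Extended_Nat"
begin

text \<open>Undirected graphs are pairs of a vertex set and a set of unordered pairs of vertices.\<close>

type_synonym 'a graph = "'a set \<times> 'a set set"

definition vertices :: "'a graph \<Rightarrow> 'a set" where
  "vertices G = fst G"

definition edges :: "'a graph \<Rightarrow> 'a set set" where
  "edges G = snd G"

definition proper_coloring :: "'a graph \<Rightarrow> nat \<Rightarrow> ('a \<Rightarrow> nat) \<Rightarrow> bool" where
  "proper_coloring G k f \<longleftrightarrow>
     (\<forall>v \<in> vertices G. f v < k) \<and>
     (\<forall>u \<in> vertices G. \<forall>v \<in> vertices G. {u, v} \<in> edges G \<longrightarrow> f u \<noteq> f v)"

text \<open>The value is \<open>\<infinity>\<close> (the infimum of the empty set) if no finite number of colors suffices.\<close>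

definition chromatic_number :: "'a graph \<Rightarrow> enat" where
  "chromatic_number G = Inf {enat k | k. \<exists>f. proper_coloring G k f}"

text \<open>Both uses below have \<open>D = - D\<close>, so adjacency of \<open>u\<close> and \<open>v\<close> is exactly \<open>u - v \<in> D\<close>.\<close>

definition difference_graph :: "'a::ab_group_add set \<Rightarrow> 'a set \<Rightarrow> 'a graph" where
  "difference_graph V D = (V, {{u, v} | u v. u \<in> V \<and> v \<in> V \<and> u - v \<in> D})"

text \<open>The unit distance graph of the Minkowski plane with unit circle \<open>C\<close>; its chromatic number
  is the chromatic number of that plane.\<close>

definition minkowski_plane_graph :: "(real^2) set \<Rightarrow> (real^2) graph" where
  "minkowski_plane_graph C = difference_graph UNIV C"

definition rotation :: "real \<Rightarrow> real^2 \<Rightarrow> real^2" where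
  "rotation t p = vector [cos t * p $ 1 - sin t * p $ 2, sin t * p $ 1 + cos t * p $ 2]"

definition octagonal_orbit :: "real^2 \<Rightarrow> (real^2) set" where
  "octagonal_orbit p = (\<lambda>k. rotation (real k * pi / 4) p) ` {0..7}"

text \<open>The boundary curve of a regular octagon centered at the origin, of any size and orientation.\<close>

definition regular_octagon :: "(real^2) set \<Rightarrow> bool" where
  "regular_octagon C \<longleftrightarrow> (\<exists>p. p \<noteq> 0 \<and> C = frontier (convex hull (octagonal_orbit p)))"

definition pt :: "int \<Rightarrow> int \<Rightarrow> int \<Rightarrow> int \<Rightarrow> real^2" where
  "pt a b c d = vector [of_int a + of_int b * sqrt 2, of_int c + of_int d * sqrt 2]"

definition W80 :: "(real^2) set" where
  "W80 = (\<Union>p \<in> {pt 4 0 0 0, pt 2 1 0 1, pt (-2) 4 (-2) 2, pt 6 (-2) 2 0, pt 12 (-6) 4 (-2),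
                  pt (-8) 8 (-4) 4, pt (-6) 7 (-4) 3, pt 10 (-5) 4 (-1), pt 8 (-3) 2 (-1),
                  pt (-4) 5 (-2) 3}. octagonal_orbit p)"

definition S15 :: "(real^2) set" where
  "S15 = {pt (-4) 4 0 0, pt (-4) 5 2 (-1), pt (-2) 2 6 (-4), pt (-2) 3 (-4) 3,
          pt (-2) 4 (-2) 2, pt 0 1 2 (-1), pt 0 2 4 (-2), pt 2 (-1) (-4) 3,
          pt 2 0 (-2) 2, pt 2 1 0 1, pt 2 2 2 0, pt 4 0 (-4) 4,
          pt 4 0 0 0, pt 6 (-2) 2 0, pt 6 (-1) 0 1}"

definition G120 :: "(real^2) graph" where
  "G120 = difference_graph (\<Union>s \<in> S15. octagonal_orbit s) W80"

end

theory Submission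
  imports Defs
begin

text \<open>
  The vertices are indexed by \<open>(i, a)\<close>, the rotation by \<open>a pi / 4\<close> of the \<open>i\<close>-th point of \<^const>\<open>S15\<close>;
  everything is then computed on integer coordinates, which is faithful since \<open>sqrt 2\<close> is irrational.

  A case analysis refuting 4-colorability is long, but rotation invariance shortens it considerably:
  if two vertices \<open>u\<close>, \<open>v\<close> get different colors in every 4-coloring, so do all eight rotations of the
  pair, which may thus be added to the graph as edges. Three such pairs, each with a small search tree,
  leave a graph with a small search tree.

  For the plane, a similarity takes \<^const>\<open>W80\<close> into any given regular octagon, so a coloring of the
  plane pulls back to one of \<^const>\<open>G120\<close>.
\<close>

section \<open>Search trees for 4-colorings\<close>

text \<open>A table has one row per octagonal orbit; the entry \<open>(j, k)\<close> in row \<open>i\<close> says that, for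
  every \<open>a\<close>, vertex \<open>a\<close> of orbit \<open>i\<close> is joined to vertex \<open>(a + k) mod 8\<close> of orbit \<open>j\<close>.\<close>

type_synonym table = "(nat \<times> nat) list list"

text \<open>\<open>Node i a ts\<close> branches on the color of vertex \<open>(i, a)\<close>; \<open>ts\<close> has one subtree for each color
  not yet blocked by a neighbor, in increasing order, so a forced vertex has one subtree and a
  contradiction none.\<close>

datatype tree = Node nat nat "tree list"

definition nbrs :: "table \<Rightarrow> nat \<Rightarrow> nat \<Rightarrow> (nat \<times> nat) list" where
  "nbrs A i a = map (\<lambda>(j, k). (j, (a + k) mod 8)) (A ! i)"

text \<open>The bounds on \<open>length A\<close> and \<open>j\<close> make well-formedness of the
  table part of the predicate, so it is available wherever a coloring is.\<close>

definition proper4 :: "table \<Rightarrow> (nat \<Rightarrow> nat \<Rightarrow> nat) \<Rightarrow> bool" where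
  "proper4 A c \<longleftrightarrow> length A = 15 \<and> (\<forall>i<15. \<forall>a<8. c i a < 4 \<and>
     (\<forall>(j, b) \<in> set (nbrs A i a). j < 15 \<and> c i a \<noteq> c j b))"

lemma proper4D:
  assumes "proper4 A c" "i < 15" "a < 8"
  shows "c i a < 4" "(j, b) \<in> set (nbrs A i a) \<Longrightarrow> j < 15 \<and> b < 8 \<and> c i a \<noteq> c j b"
  using assms by (fastforce simp: proper4_def nbrs_def)+

text \<open>A partial coloring is a list of rows, the entry 4 marking an uncolored vertex.\<close>

definition put :: "nat \<Rightarrow> nat \<Rightarrow> nat \<Rightarrow> nat list list \<Rightarrow> nat list list" where
  "put i a x st = st[i := (st ! i)[a := x]]"

text \<open>The marker 4 is not among the four colors, so uncolored neighbors block nothing.\<close>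

definition free :: "table \<Rightarrow> nat list list \<Rightarrow> nat \<Rightarrow> nat \<Rightarrow> nat list" where
  "free A st i a = (let used = map (\<lambda>(j, b). st ! j ! b) (nbrs A i a)
     in filter (\<lambda>x. x \<notin> set used) [0, 1, 2, 3])"

text \<open>The tree is an untrusted certificate recording only the branching vertices; partial
  colorings and free colors are recomputed on the way down. A leaf is accepted only if no color is
  free.\<close>

function refutes :: "table \<Rightarrow> nat list list \<Rightarrow> tree \<Rightarrow> bool" where
  "refutes A st (Node i a ts) \<longleftrightarrow> i < 15 \<and> a < 8 \<and>
     (let xs = free A st i a in length xs = length ts \<and>
       (\<forall>(x, t) \<in> set (zip xs ts). refutes A (put i a x st) t))"
  by pat_completeness auto
termination
  by (relation "Wellfounded.measure (\<lambda>(A, st, t). size t)")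
    (auto dest!: set_zip_rightD simp: less_Suc_eq_le size_list_estimation')

definition agrees :: "nat list list \<Rightarrow> (nat \<Rightarrow> nat \<Rightarrow> nat) \<Rightarrow> bool" where
  "agrees st c \<longleftrightarrow> length st = 15 \<and> (\<forall>i<15. length (st ! i) = 8 \<and>
     (\<forall>a<8. st ! i ! a < 4 \<longrightarrow> st ! i ! a = c i a))"

lemma agrees_put: "agrees st c \<Longrightarrow> agrees (put i a (c i a) st) c"
  unfolding agrees_def put_def
  by (cases "i < 15"; cases "a < 8") (simp_all add: nth_list_update)

text \<open>Any proper \<open>c\<close> compatible with the state selects a branch: its color at
  \<open>(i, a)\<close> is free, and assigning it preserves compatibility. The descent would end at
  a leaf, where no color is free.\<close>

lemma refutes_sound:
  assumes "refutes A st t" "agrees st c" "proper4 A c"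
  shows False
  using assms
proof (induction A st t rule: refutes.induct)
  case (1 A st i a ts)
  have ia: "i < 15" "a < 8" and len: "length (free A st i a) = length ts"
    and sub: "\<And>x t. (x, t) \<in> set (zip (free A st i a) ts) \<Longrightarrow> refutes A (put i a x st) t"
    using "1.prems"(1) by (auto simp: Let_def)
  \<comment> \<open>An entry below 4 equals \<open>c j b\<close>, which differs from
    \<open>c i a\<close>; an entry of 4 or more differs from every color.\<close>
  have "c i a \<noteq> st ! j ! b" if "(j, b) \<in> set (nbrs A i a)" for j b
  proof -
    from proper4D[OF "1.prems"(3) ia] that have "j < 15" "b < 8" "c i a < 4" "c i a \<noteq> c j b"
      by auto
    then show ?thesis using "1.prems"(2) by (auto simp: agrees_def)
  qed
  moreover have "c i a \<in> {0, 1, 2, 3}"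
    using proper4D(1)[OF "1.prems"(3) ia] by (auto simp: less_Suc_eq numeral_eq_Suc)
  ultimately have "c i a \<in> set (free A st i a)"
    unfolding free_def Let_def set_filter by auto
  then obtain n where n: "n < length ts" "free A st i a ! n = c i a"
    using len by (auto simp: in_set_conv_nth)
  then have mem: "(c i a, ts ! n) \<in> set (zip (free A st i a) ts)"
    using nth_mem[of n "zip (free A st i a) ts"] n len by simp
  show False
    by (rule "1.IH"[OF refl mem refl sub[OF mem] agrees_put[OF "1.prems"(2)] "1.prems"(3)])
qed

section \<open>Renaming the colors of a triangle\<close>

lemma color_normalization:
  assumes "distinct [p, q, r]" "p < 4" "q < 4" "r < (4::nat)"
  obtains g :: "nat \<Rightarrow> nat"
  where "g p = 0" "g q = 1" "g r = 2" "\<forall>x. g x < 4" "inj_on g {..<4}"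
proof -
  \<comment> \<open>Three of the four colors are taken, so at most one is left, and sending
    everything else to 3 is injective on \<open>{..<4}\<close>.\<close>
  have unique: "x = y" if "x < 4" "y < 4" "x \<notin> {p, q, r}" "y \<notin> {p, q, r}" for x y
  proof (rule ccontr)
    assume "x \<noteq> y"
    with that assms have "card {p, q, r, x, y} = 5" by auto
    moreover have "card {p, q, r, x, y} \<le> card {..<4::nat}"
      using that assms by (intro card_mono) auto
    ultimately show False by simp
  qed
  let ?g = "\<lambda>x. if x = p then 0 else if x = q then 1 else if x = r then 2 else 3 :: nat"
  have "inj_on ?g {..<4}"
  proof (rule inj_onI)
    fix x y assume "x \<in> {..<4}" "y \<in> {..<4}" "?g x = ?g y"
    then show "x = y" using unique[of x y] by (auto split: if_splits)
  qed
  then show thesis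
    using assms(1) by (intro that[of ?g]) auto
qed

definition initial ::
  "nat \<times> nat \<Rightarrow> nat \<times> nat \<Rightarrow> nat \<times> nat \<Rightarrow> (nat \<times> nat) list \<Rightarrow> nat list list" where
  "initial p q r same = fold (\<lambda>((i, a), x). put i a x)
     ([(p, 0), (q, 1), (r, 2)] @ map (\<lambda>v. (v, 0)) same) (replicate 15 (replicate 8 4))"

text \<open>\<open>conflict A p q r same t\<close>: the triangle \<open>p, q, r\<close> may be colored 0, 1, 2 without loss of
  generality, and \<open>t\<close> then refutes that all of \<open>same\<close> have the color of \<open>p\<close>.\<close>

definition conflict ::
  "table \<Rightarrow> nat \<times> nat \<Rightarrow> nat \<times> nat \<Rightarrow> nat \<times> nat \<Rightarrow> (nat \<times> nat) list \<Rightarrow> tree \<Rightarrow> bool" where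
  "conflict A p q r same t \<longleftrightarrow>
     (\<forall>(i, a) \<in> set (p # q # r # same). i < 15 \<and> a < 8) \<and>
     q \<in> set (nbrs A (fst p) (snd p)) \<and> r \<in> set (nbrs A (fst p) (snd p)) \<and>
     r \<in> set (nbrs A (fst q) (snd q)) \<and>
     refutes A (initial p q r same) t"

lemma proper4_comp:
  assumes "proper4 A c" "inj_on g {..<4}" "\<forall>x. g x < 4"
  shows "proper4 A (\<lambda>i a. g (c i a))"
proof -
  have "g (c i a) \<noteq> g (c j b)" if "i < 15" "a < 8" "(j, b) \<in> set (nbrs A i a)" for i a j b
    using proper4D[OF assms(1) that(1,2)] proper4D(1)[OF assms(1), of j b] that(3) assms(2)
    by (auto simp: inj_on_def)
  then show ?thesis
    using assms(1,3) by (fastforce simp: proper4_def)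
qed

lemma agrees_fold_put:
  assumes "agrees st c" "\<forall>((i, a), x) \<in> set vs. c i a = x"
  shows "agrees (fold (\<lambda>((i, a), x). put i a x) vs st) c"
  using assms by (induction vs arbitrary: st) (auto dest: agrees_put)

text \<open>Renaming turns \<open>c\<close> into a coloring that extends \<open>initial\<close>.
  With \<open>same\<close> empty this excludes all 4-colorings; with a single vertex it shows that
  this vertex and \<open>p\<close> never share a color.\<close>

lemma conflict_sound:
  assumes "conflict A p q r same t" "proper4 A c"
    and same: "\<forall>(i, a) \<in> set same. c i a = c (fst p) (snd p)"
  shows False
proof -
  let ?c = "\<lambda>v. c (fst v) (snd v)"
  have "distinct [?c p, ?c q, ?c r]" "?c p < 4" "?c q < 4" "?c r < 4"
    using assms(1,2) unfolding conflict_def proper4_def by (auto split: prod.splits)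
  then obtain g :: "nat \<Rightarrow> nat" where g: "g (?c p) = 0" "g (?c q) = 1" "g (?c r) = 2"
    "\<forall>x. g x < 4" "inj_on g {..<4}" by (rule color_normalization)
  have "agrees (replicate 15 (replicate 8 4)) (\<lambda>i a. g (c i a))"
    by (auto simp: agrees_def)
  then have "agrees (initial p q r same) (\<lambda>i a. g (c i a))"
    unfolding initial_def by (rule agrees_fold_put) (use g(1-3) same in auto)
  moreover have "refutes A (initial p q r same) t"
    using assms(1) by (simp add: conflict_def)
  ultimately show False
    by (intro refutes_sound[OF _ _ proper4_comp[OF assms(2) g(5,4)]])
qed

section \<open>Rotation invariance and additional edges\<close>

definition add_pair :: "nat \<Rightarrow> nat \<Rightarrow> nat \<Rightarrow> table \<Rightarrow> table" where
  "add_pair i j k A = (let B = A[i := (j, k) # A ! i] in B[j := (i, 8 - k) # B ! j])"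

text \<open>The table depends only on differences of positions modulo 8, so shifting all positions
  by \<open>m\<close> is an automorphism.\<close>

lemma proper4_shift:
  assumes "proper4 A c"
  shows "proper4 A (\<lambda>i a. c i ((a + m) mod 8))"
proof -
  have "((a + k) mod 8 + m) mod 8 = ((a + m) mod 8 + k) mod (8::nat)" for a k
    by (simp add: mod_simps ac_simps)
  with assms show ?thesis
    unfolding proper4_def by (auto simp: nbrs_def split: prod.splits)
qed

text \<open>Rotating a coloring gives a coloring, so two vertices that can never share a color act as
  an additional edge, together with all rotations of this edge.\<close>

lemma proper4_add_pair:
  assumes "\<And>c. proper4 A c \<Longrightarrow> c i 0 \<noteq> c j k" "proper4 A c" "i < 15" "j < 15" "k < 8"
  shows "proper4 (add_pair i j k A) c"
proof -
  have fw: "c i a \<noteq> c j ((a + k) mod 8)" if "a < 8" for a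
    using assms(1)[OF proper4_shift[OF assms(2), of a]] that by (simp add: add.commute)
  have bw: "c j a \<noteq> c i ((a + (8 - k)) mod 8)" if "a < 8" for a
  proof -
    have "((a + (8 - k)) mod 8 + k) mod 8 = a" using that assms(5) by (simp add: mod_simps)
    with fw[of "(a + (8 - k)) mod 8"] show ?thesis by auto
  qed
  have "length A = 15" using assms(2) by (simp add: proper4_def)
  then show ?thesis
    using assms(2-) fw bw unfolding proper4_def add_pair_def Let_def nbrs_def
    by (auto simp: nth_list_update split: prod.splits)
qed

lemma proper4_extend:
  assumes "conflict A (i, 0) q r [(j, k)] t" "proper4 A c"
  shows "proper4 (add_pair i j k A) c"
proof (rule proper4_add_pair[OF _ assms(2)])
  show "c i 0 \<noteq> c j k" if "proper4 A c" for c
    using conflict_sound[OF assms(1) that] by auto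
  show "i < 15" "j < 15" "k < 8" using assms(1) unfolding conflict_def by simp_all
qed

section \<open>Rotations and integer coordinates\<close>

definition rot :: "nat \<Rightarrow> real^2 \<Rightarrow> real^2" where
  "rot k = rotation (real k * pi / 4)"

lemma rotation_nth [simp]:
  "rotation t p $ 1 = cos t * p $ 1 - sin t * p $ 2"
  "rotation t p $ 2 = sin t * p $ 1 + cos t * p $ 2"
  by (simp_all add: rotation_def)

lemma rotation_add: "rotation (s + t) p = rotation s (rotation t p)"
  by (simp add: vec_eq_iff forall_2 cos_add sin_add algebra_simps)

lemma rotation_diff: "rotation t (p - q) = rotation t p - rotation t q"
  by (simp add: vec_eq_iff forall_2 algebra_simps)

lemma rot_add: "rot (j + k) p = rot j (rot k p)"
  by (simp add: rot_def rotation_add [symmetric] add_divide_distrib distrib_right)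

lemma rot_diff: "rot k (p - q) = rot k p - rot k q"
  by (simp add: rot_def rotation_diff)

lemma rot_0 [simp]: "rot 0 p = p"
  by (simp add: rot_def vec_eq_iff forall_2)

lemma rot_eight_mult: "rot (8 * n) p = p"
proof -
  have "real (8 * n) * pi / 4 = 2 * real n * pi" by simp
  then show ?thesis
    by (simp only: rot_def vec_eq_iff forall_2 rotation_nth sin_2npi cos_2npi) simp
qed

lemma rot_mod: "rot (k mod 8) p = rot k p"
  by (metis rot_add rot_eight_mult mult_div_mod_eq)

lemma octagonal_orbit_eq: "octagonal_orbit p = range (\<lambda>k. rot k p)"
proof -
  have "rot k p \<in> (\<lambda>k. rot k p) ` {0..7}" for k
    by (rule image_eqI[of _ _ "k mod 8"]) (auto simp: rot_mod)
  then show ?thesis by (auto simp: octagonal_orbit_def rot_def)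
qed

lemma rot_inverse: "rot (7 * k) (rot k p) = p"
  using rot_eight_mult[of k p] by (simp add: rot_add[symmetric])

lemma rot_in_octagonal_orbit_iff: "rot k q \<in> octagonal_orbit p \<longleftrightarrow> q \<in> octagonal_orbit p"
proof
  assume "rot k q \<in> octagonal_orbit p"
  then obtain m where "rot k q = rot m p" by (auto simp: octagonal_orbit_eq)
  then have "q = rot (7 * k + m) p" by (metis rot_add rot_inverse)
  then show "q \<in> octagonal_orbit p" by (auto simp: octagonal_orbit_eq)
qed (auto simp: octagonal_orbit_eq rot_add[symmetric])

lemma octagonal_orbit_rot: "octagonal_orbit (rot k p) = octagonal_orbit p"
proof -
  have "rot m p = rot (m + 7 * k) (rot k p)" for m by (simp add: rot_add rot_inverse)
  then have "rot m p \<in> range (\<lambda>m. rot m (rot k p))" for m by (metis rangeI)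
  then show ?thesis unfolding octagonal_orbit_eq by (auto simp: rot_add[symmetric])
qed

lemma rot_in_W80_iff: "rot k w \<in> W80 \<longleftrightarrow> w \<in> W80"
  by (simp only: W80_def UN_iff rot_in_octagonal_orbit_iff)

text \<open>\<open>rotq\<close> is rotation by \<open>pi / 4\<close> on the integer coordinates of \<open>pt\<close>. Its halves are exact
  only under \<open>evenq\<close>, which holds for all points involved.\<close>

type_synonym quad = "int \<times> int \<times> int \<times> int"

fun point :: "quad \<Rightarrow> real^2" where "point (a, b, c, d) = pt a b c d"

fun rotq :: "quad \<Rightarrow> quad" where
  "rotq (a, b, c, d) = (b - d, (a - c) div 2, b + d, (a + c) div 2)"

fun evenq :: "quad \<Rightarrow> bool" where "evenq (a, b, c, d) = even (a - c)"

lemma pt_nth [simp]: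
  "pt a b c d $ 1 = of_int a + of_int b * sqrt 2" "pt a b c d $ 2 = of_int c + of_int d * sqrt 2"
  by (simp_all add: pt_def)

text \<open>Rotation by \<open>pi / 4\<close> sends \<open>(x, y)\<close> to
  \<open>((x - y) / sqrt 2, (x + y) / sqrt 2)\<close>, and \<open>(u + v * sqrt 2) / sqrt 2\<close>
  is \<open>v + u / 2 * sqrt 2\<close>. Parity persists because the new difference is
  \<open>- 2 * d\<close>.\<close>

lemma point_rotq: "evenq q \<Longrightarrow> evenq (rotq q) \<and> point (rotq q) = rot 1 (point q)"
proof (cases q)
  case (fields a b c d)
  assume "evenq q"
  then obtain m where "a - c = 2 * m" unfolding fields evenq.simps by (rule evenE)
  then have "a = c + 2 * m" by simp
  with fields show ?thesis
    by (simp add: rot_def vec_eq_iff forall_2 cos_45 sin_45 field_simps)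
qed

lemma point_rotq_pow: "evenq q \<Longrightarrow> evenq ((rotq ^^ k) q) \<and> point ((rotq ^^ k) q) = rot k (point q)"
proof (induction k)
  case (Suc k)
  then show ?case
    using point_rotq[of "(rotq ^^ k) q"] rot_add[of 1 k "point q"] by simp
qed simp

section \<open>Irrationality of \<open>sqrt 2\<close> and uniqueness of coordinates\<close>

lemma even_square_descent: "m * m = 2 * (n * n) \<Longrightarrow> n = (0::nat)"
proof (induction n arbitrary: m rule: less_induct)
  case (less n)
  show ?case
  proof (rule ccontr)
    assume "n \<noteq> 0"
    from less.prems have "even m" by (metis dvd_triv_left even_mult_iff)
    then obtain k where "m = 2 * k" by auto
    \<comment> \<open>The pair \<open>(n, k)\<close> solves the same equation, and
      \<open>k < n\<close> gives the descent.\<close>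
    with less.prems have k: "n * n = 2 * (k * k)" by simp
    have "k < n"
    proof (rule ccontr)
      assume "\<not> k < n"
      then have "n * n \<le> k * k" by (simp add: mult_le_mono)
      with k \<open>n \<noteq> 0\<close> show False by simp
    qed
    with less.IH[OF this k] k \<open>n \<noteq> 0\<close> show False by simp
  qed
qed

lemma sqrt2_lincomb_eq_0:
  assumes "of_int a + of_int b * sqrt 2 = 0"
  shows "a = 0 \<and> b = 0"
proof -
  from assms have "of_int a = - (of_int b * sqrt 2)" by linarith
  then have "(of_int a)\<^sup>2 = 2 * (of_int b :: real)\<^sup>2" by (simp add: power_mult_distrib)
  then have "a * a = 2 * (b * b)"
    by (simp add: power2_eq_square flip: of_int_mult of_int_eq_iff[where 'a = real])
  then have "nat \<bar>a\<bar> * nat \<bar>a\<bar> = 2 * (nat \<bar>b\<bar> * nat \<bar>b\<bar>)"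
    by (simp flip: nat_mult_distrib abs_mult)
  from even_square_descent[OF this] have "b = 0" by simp
  with assms show ?thesis by simp
qed

lemma inj_point: "inj point"
proof (rule injI)
  fix p q assume eq: "point p = point q"
  obtain a b c d a' b' c' d' where pq: "p = (a, b, c, d)" "q = (a', b', c', d')"
    by (metis prod_cases4)
  have "of_int (a - a') + of_int (b - b') * sqrt 2 = 0" "of_int (c - c') + of_int (d - d') * sqrt 2 = 0"
    using eq unfolding pq by (simp_all add: vec_eq_iff forall_2 algebra_simps)
  from this[THEN sqrt2_lincomb_eq_0] show "p = q" by (simp add: pq)
qed

definition orbit_list :: "quad \<Rightarrow> quad list" where
  "orbit_list q = map (\<lambda>k. (rotq ^^ k) q) [0..<8]"

lemma octagonal_orbit_point: "evenq q \<Longrightarrow> octagonal_orbit (point q) = point ` set (orbit_list q)"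
  by (simp add: octagonal_orbit_def orbit_list_def image_image point_rotq_pow rot_def
      atLeastLessThanSuc_atLeastAtMost [of 0 7, simplified])

section \<open>The boundary of the octagon\<close>

lemma cos_sin_eighth:
  assumes h: "h = sqrt 2 / 2"
  shows "(cos (real k * pi / 4), sin (real k * pi / 4)) \<in>
    {(1, 0), (h, h), (0, 1), (- h, h), (- 1, 0), (- h, - h), (0, - 1), (h, - h)}"
proof (induction k)
  case (Suc k)
  \<comment> \<open>Keeping \<open>h\<close> symbolic, with this one relation, makes the eight cases
    polynomial identities.\<close>
  have hh: "h * h = 1 / 2" by (simp add: h)
  have *: "real (Suc k) * pi / 4 = real k * pi / 4 + pi / 4" by (simp add: field_simps)
  have "cos (real (Suc k) * pi / 4) = (cos (real k * pi / 4) - sin (real k * pi / 4)) * h"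
    "sin (real (Suc k) * pi / 4) = (sin (real k * pi / 4) + cos (real k * pi / 4)) * h"
    unfolding * cos_add sin_add cos_45 sin_45 h by (simp_all add: algebra_simps)
  with Suc show ?case by (elim insertE) (simp_all add: hh algebra_simps)
qed simp

text \<open>Supporting line: \<open>n \<bullet> x \<le> b\<close> holds at all vertices and hence on
  the hull, with equality along the side. A point of the hull on this line cannot be
  interior.\<close>

lemma edge_subset_frontier:
  assumes "p \<noteq> 0" "0 \<le> t" "t \<le> 1"
  shows "(1 - t) *\<^sub>R p + t *\<^sub>R rot 1 p \<in> frontier (convex hull (octagonal_orbit p))"
    (is "?w \<in> frontier ?H")
proof -
  \<comment> \<open>\<open>n\<close> is normal to the side from \<open>p\<close> to \<open>rot 1 p\<close>\<close>
  define n where "n = p + rot 1 p"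
  define b where "b = (1 + sqrt 2 / 2) * (p \<bullet> p)"
  have pos: "p \<bullet> p > 0" using assms(1) by simp
  have rot_inner: "n \<bullet> rot k p =
      (cos (real k * pi / 4) + sqrt 2 / 2 * (cos (real k * pi / 4) + sin (real k * pi / 4))) * (p \<bullet> p)"
    for k
    by (simp add: n_def rot_def inner_vec_def sum_2 cos_45 sin_45 field_simps)
  \<comment> \<open>The maximum \<open>1 + h\<close> is attained at \<open>(1, 0)\<close> and
    \<open>(h, h)\<close>, which correspond to the two ends of the side.\<close>
  have extremal: "x + h * (x + y) \<le> 1 + h" if "h = sqrt 2 / 2" and
    "(x, y) \<in> {(1, 0), (h, h), (0, 1), (- h, h), (- 1, 0), (- h, - h), (0, - 1), (h, - h)}"
    for x y h :: real
  proof -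
    have "h * h = 1 / 2" "0 \<le> h" "h \<le> 1"
      unfolding that(1) using sqrt2_less_2 by simp_all
    with that(2) show ?thesis by (elim insertE) (simp_all add: algebra_simps)
  qed
  have "n \<bullet> rot k p \<le> b" for k
    using extremal[OF refl cos_sin_eighth[OF refl], of k] pos
    unfolding rot_inner b_def by (simp add: mult_right_mono)
  then have "octagonal_orbit p \<subseteq> {x. n \<bullet> x \<le> b}" by (auto simp: octagonal_orbit_eq)
  then have "?H \<subseteq> {x. n \<bullet> x \<le> b}" by (rule hull_minimal) (rule convex_halfspace_le)
  then have "interior ?H \<subseteq> interior {x. n \<bullet> x \<le> b}" by (rule interior_mono)
  moreover have eq: "n \<bullet> p = b" "n \<bullet> rot 1 p = b"
    using rot_inner[of 0] rot_inner[of 1] by (simp_all add: b_def cos_45 sin_45 algebra_simps)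
  moreover have "0 < b"
    unfolding b_def using pos by (intro mult_pos_pos add_pos_nonneg) simp_all
  \<comment> \<open>For nonzero \<open>n\<close> the interior of the half-plane is the open
    half-plane, which misses \<open>?w\<close>.\<close>
  with eq have "n \<noteq> 0" by auto
  moreover have "n \<bullet> ?w = b" by (simp add: inner_add_right eq[simplified] algebra_simps)
  ultimately have "?w \<notin> interior ?H" by auto
  moreover have "?w \<in> ?H"
  proof (rule convexD_alt[OF convex_convex_hull])
    show "p \<in> ?H" "rot 1 p \<in> ?H"
      using rangeI[of "\<lambda>k. rot k p" 0] rangeI[of "\<lambda>k. rot k p" 1]
      by (auto simp: octagonal_orbit_eq intro: hull_inc)
  qed (use assms in auto)
  ultimately show ?thesis
    using closure_subset by (auto simp: frontier_def)
qed

section \<open>The adjacency table\<close>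

definition S_list :: "quad list" where
  "S_list = [(-4, 4, 0, 0), (-4, 5, 2, -1), (-2, 2, 6, -4), (-2, 3, -4, 3), (-2, 4, -2, 2),
     (0, 1, 2, -1), (0, 2, 4, -2), (2, -1, -4, 3), (2, 0, -2, 2), (2, 1, 0, 1), (2, 2, 2, 0),
     (4, 0, -4, 4), (4, 0, 0, 0), (6, -2, 2, 0), (6, -1, 0, 1)]"

definition W_list :: "quad list" where
  "W_list = concat (map orbit_list [(4, 0, 0, 0), (2, 1, 0, 1), (-2, 4, -2, 2), (6, -2, 2, 0),
     (12, -6, 4, -2), (-8, 8, -4, 4), (-6, 7, -4, 3), (10, -5, 4, -1), (8, -3, 2, -1),
     (-4, 5, -2, 3)])"

fun diffq :: "quad \<Rightarrow> quad \<Rightarrow> quad" where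
  "diffq (a, b, c, d) (a', b', c', d') = (a - a', b - b', c - c', d - d')"

text \<open>For a rotation-invariant \<open>W\<close> it suffices to compare the first point of each
  orbit with all points of \<open>P\<close>.\<close>

definition adjacency :: "quad list \<Rightarrow> quad list list \<Rightarrow> table" where
  "adjacency W P = map (\<lambda>r. filter (\<lambda>(j, k). diffq (r ! 0) (P ! j ! k) \<in> set W)
     (List.product [0..<15] [0..<8])) P"

definition adj :: table where
  "adj = [[(1,2), (3,3), (3,4), (4,6), (6,2), (6,5), (8,3), (8,4), (10,0), (10,7), (11,1), (11,6), (13,1)],
   [(0,6), (2,3), (2,5), (3,2), (3,6), (5,2), (7,4), (11,1), (13,1), (14,1)],
   [(1,3), (1,5), (4,2), (4,6), (6,3), (6,5), (9,2), (9,6), (11,1), (11,7), (12,2), (12,7), (13,2), (13,6)],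
   [(0,4), (0,5), (1,2), (1,6), (5,4), (8,5), (9,6), (11,1), (13,1), (14,1)],
   [(0,2), (2,2), (2,6), (5,6), (7,2), (7,6), (8,6), (11,1), (12,7), (13,1), (14,1)],
   [(1,6), (3,4), (4,2), (8,4), (9,2), (9,6), (10,0), (12,2), (12,7), (13,6), (14,1), (14,7)],
   [(0,3), (0,6), (2,3), (2,5), (7,4), (8,2), (8,6), (10,1), (10,7), (12,2), (12,7), (14,7)],
   [(1,4), (4,2), (4,6), (6,4), (9,2), (9,6), (11,0), (12,2), (12,7), (13,2), (13,6)],
   [(0,4), (0,5), (3,3), (4,2), (5,4), (6,2), (6,6), (8,3), (8,5), (10,1), (10,7), (12,2), (12,7), (13,6), (14,7)],
   [(2,2), (2,6), (3,2), (5,2), (5,6), (7,2), (7,6), (10,1), (10,7), (14,7)],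
   [(0,0), (0,1), (5,0), (6,1), (6,7), (8,1), (8,7), (9,1), (9,7), (10,1), (10,7), (11,1), (11,7)],
   [(0,2), (0,7), (1,7), (2,1), (2,7), (3,7), (4,7), (7,0), (10,1), (10,7), (13,1), (14,7)],
   [(2,1), (2,6), (4,1), (5,1), (5,6), (6,1), (6,6), (7,1), (7,6), (8,1), (8,6), (13,6)],
   [(0,7), (1,7), (2,2), (2,6), (3,7), (4,7), (5,2), (7,2), (7,6), (8,2), (11,7), (12,2)],
   [(1,7), (3,7), (4,7), (5,1), (5,7), (6,1), (8,1), (9,1), (11,1)]]"

text \<open>A 5-coloring, the witness for the upper bound. Here 4 is the fifth color, not the marker
  of an uncolored vertex.\<close>

definition colors :: "nat list list" where
  "colors = [[3, 1, 2, 2, 4, 3, 0, 4],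
   [4, 1, 4, 0, 1, 1, 1, 4],
   [3, 3, 3, 2, 3, 3, 3, 2],
   [2, 1, 3, 2, 0, 3, 0, 0],
   [4, 3, 0, 0, 1, 3, 0, 0],
   [2, 1, 2, 2, 3, 2, 0, 0],
   [1, 1, 0, 2, 0, 4, 0, 0],
   [3, 3, 2, 2, 3, 3, 3, 4],
   [1, 1, 2, 2, 4, 4, 3, 0],
   [1, 1, 4, 4, 4, 1, 0, 0],
   [4, 3, 0, 1, 0, 1, 3, 2],
   [1, 1, 0, 1, 4, 2, 0, 2],
   [2, 1, 4, 2, 1, 4, 1, 0],
   [1, 0, 2, 1, 4, 3, 4, 4],
   [3, 3, 0, 1, 3, 4, 4, 4]]"

lemma distinct_W: "distinct W_list" "length W_list = 80" "(0, 0, 0, 0) \<notin> set W_list"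
  by code_simp+

lemma distinct_V: "distinct (concat (map orbit_list S_list))"
  by code_simp

lemma adj_eq: "adjacency W_list (map orbit_list S_list) = adj"
  by code_simp

lemma adj_bounds: "length adj = 15" "\<forall>r\<in>set adj. \<forall>(j, k)\<in>set r. j < 15 \<and> k < 8"
  by code_simp+

text \<open>Distinctness lets the list lengths count neighbors; the degree sum 1408 is twice
  704.\<close>

lemma nbrs_adj:
  "\<forall>i\<in>set [0..<15]. \<forall>a\<in>set [0..<8]. distinct (nbrs adj i a)"
  "sum_list (map (\<lambda>(i, a). length (nbrs adj i a)) (List.product [0..<15] [0..<8])) = 1408"
  by code_simp+

lemma colors_adj:
  "\<forall>i\<in>set [0..<15]. \<forall>a\<in>set [0..<8]. colors ! i ! a < 5 \<and>
     (\<forall>(j, b)\<in>set (nbrs adj i a). colors ! i ! a \<noteq> colors ! j ! b)"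
  by code_simp

section \<open>The graph has no 4-coloring\<close>

text \<open>Orbits 0 and 8 are already joined at offsets 3 and 4. Starting from the triangle
  \<open>(0, 0)\<close>, \<open>(6, 5)\<close>, \<open>(8, 3)\<close>, the tree rules out a common
  color at offset 5.\<close>

lemma conflict_1:
  "conflict adj (0, 0) (6, 5) (8, 3) [(8, 5)] (
Node 10 4 [Node 8 0 [Node 6 2 [Node 0 5 [Node 12 4 [Node 0 4 [Node 10 3 [Node 8 2 [
Node 8 4 [Node 8 7 []]]], Node 8 7 [Node 6 6 [Node 10 6 [Node 10 5 [Node 10 7 [Node 8 4 [
Node 8 6 [Node 11 6 [Node 0 1 [Node 6 3 [Node 10 0 [Node 8 1 [Node 6 7 [Node 12 1 [
Node 5 2 [Node 7 2 [Node 8 2 [Node 6 0 [Node 2 5 [Node 13 7 [Node 0 6 [Node 11 7 [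
Node 2 0 [Node 4 2 [Node 9 6 [Node 12 2 [Node 5 4 [Node 4 3 [Node 14 3 [Node 2 1 [
Node 13 3 [Node 0 2 [Node 1 2 [Node 4 0 [Node 3 0 [Node 11 1 []]]]]]]]]]]]]]]]]]]]]]]]]]]
, Node 6 3 [Node 10 0 [Node 8 1 [Node 12 5 [Node 6 7 [Node 6 1 [Node 5 5 [Node 12 1 [
Node 12 0 [Node 9 7 [Node 5 7 [Node 8 2 [Node 2 1 [Node 9 5 [Node 6 0 [Node 2 3 [
Node 3 7 [Node 2 5 [Node 11 0 [Node 11 4 [Node 13 1 [Node 13 5 [Node 3 0 [Node 3 4 [
Node 1 6 [Node 1 2 [Node 5 0 [Node 5 4 [Node 9 6 []]]]]]]]]]]]]]]]]]]]]]]]]]]]]]]]]]],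
Node 10 7 [Node 6 1 [Node 0 7 [Node 10 0 [Node 4 5 [Node 10 1 [Node 11 6 [Node 10 2 [
Node 0 3 [Node 11 1 [Node 3 0 [Node 13 1 [Node 11 0 [Node 1 6 [Node 14 7 [Node 5 0 [
Node 8 4 [Node 9 6 [Node 4 6 [Node 5 4 [Node 11 7 [Node 9 2 [Node 2 0 []]]]]]]]],
Node 2 1 [Node 4 7 [Node 13 7 [Node 2 5 []]]]]]]]]]]]]]]], Node 10 0 [Node 6 7 [Node 2 2 [
Node 8 1 [Node 8 4 [Node 10 5 [Node 10 3 [Node 12 6 [Node 10 2 [Node 6 4 [Node 0 2 [
Node 11 3 [Node 0 7 [Node 13 4 [Node 11 5 [Node 11 0 [Node 4 3 [Node 2 4 [Node 3 4 [
Node 13 1 [Node 2 1 [Node 4 2 [Node 3 0 [Node 5 0 [Node 1 6 []]]]]]]]]]]]]]]]]]]]]]]]]]]]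
, Node 8 4 [Node 0 1 [Node 10 3 [Node 6 3 [Node 13 2 [Node 10 2 [Node 5 4 [Node 0 3 [
Node 6 1 [Node 4 6 [Node 11 1 [Node 2 4 [Node 3 0 [Node 11 3 [Node 1 2 []]]]]]]]]]]]]]]],
Node 8 4 [Node 10 6 [Node 10 5 []]]]]]], Node 12 4 [Node 10 6 [Node 10 7 [Node 8 7 [
Node 0 4 [Node 6 6 [Node 10 5 [Node 8 6 [Node 8 4 [Node 11 6 [Node 12 6 [Node 6 7 [
Node 8 1 [Node 6 3 [Node 10 0 [Node 10 1 [Node 10 2 [Node 0 3 [Node 5 2 [Node 6 0 [
Node 2 5 [Node 11 4 [Node 14 3 [Node 4 2 [Node 5 4 [Node 2 0 [Node 9 6 []]]]]]]]]]]]]]]],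
Node 6 7 [Node 6 4 [Node 8 1 [Node 10 0 [Node 0 2 [Node 0 6 [Node 5 5 [Node 10 1 [
Node 13 7 [Node 10 2 [Node 3 6 [Node 4 6 [Node 5 2 [Node 9 3 [Node 11 1 [Node 11 7 [
Node 14 7 [Node 5 1 [Node 2 2 [Node 11 0 [Node 13 0 [Node 1 7 []]]]]]]]]]]]]]]]]]]]]]]]]]]
]], Node 8 2 [Node 0 7 [Node 6 1 [Node 10 0 [Node 10 1 [Node 6 0 [Node 10 2 [Node 0 3 [
Node 11 1 [Node 8 6 [Node 5 2 [Node 8 1 [Node 14 1 [Node 0 6 [Node 1 0 []]]]]]]]]]]]]]]]]
, Node 10 7 [Node 0 4 [Node 6 6 [Node 8 7 [Node 8 4 [Node 0 1 [Node 6 3 [Node 10 1 [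
Node 10 2 [Node 6 7 [Node 12 1 [Node 2 2 [Node 5 2 [Node 9 0 []]]], Node 0 5 [Node 8 1 []]
]]]]]]]], Node 8 7 [Node 0 7 [Node 11 5 [Node 6 1 [Node 10 0 [Node 0 3 [Node 11 1 [
Node 3 0 [Node 13 1 [Node 11 0 [Node 0 2 [Node 6 7 [Node 0 5 [Node 12 1 [Node 8 1 [
Node 8 2 [Node 6 3 [Node 8 4 [Node 6 4 [Node 10 5 [Node 9 6 [Node 2 0 [Node 7 0 [
Node 4 6 []]]]]]]]]]]]], Node 6 7 [Node 10 1 [Node 12 1 [Node 2 7 [Node 1 4 [Node 13 5 [
Node 1 2 [Node 11 3 [Node 13 3 [Node 4 2 []]], Node 5 4 [Node 13 2 [Node 4 1 [Node 11 2 [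
Node 13 3 [Node 2 5 [Node 11 4 [Node 14 3 [Node 6 4 [Node 8 4 [Node 12 6 []]]]]]]]]]]]]]]]
]]]]]]], Node 10 2 [Node 10 1 [Node 0 1 [Node 8 4 [Node 6 3 [Node 8 1 [Node 0 6 [
Node 6 7 [Node 10 5 [Node 11 4 [Node 0 5 [Node 11 6 [Node 4 3 [Node 4 5 [Node 12 2 [
Node 14 6 [Node 2 0 [Node 5 5 [Node 1 3 []]]]]]]]]]]]]]]]]]]]], Node 10 0 [Node 6 7 [
Node 0 5 [Node 2 4 [Node 12 1 [Node 8 1 [Node 4 2 [Node 3 4 [Node 0 1 [Node 5 0 [
Node 6 6 [Node 13 2 [Node 7 2 [Node 8 4 [Node 1 6 [Node 10 5 [Node 3 0 [Node 9 6 []]]]]]]]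
]]]]]]]]]]]], Node 6 1 [Node 8 2 [Node 11 5 [Node 10 0 [Node 7 5 [Node 6 7 [Node 2 4 [
Node 12 6 [Node 4 7 [Node 0 1 [Node 13 0 [Node 13 2 [Node 11 7 [Node 12 2 [Node 2 0 []]]]]
]]]]]]]]]]]]]]]]], Node 12 7 [Node 12 2 [Node 2 0 [Node 10 6 [Node 10 7 [Node 6 0 [
Node 8 6 [Node 0 3 [Node 10 5 [Node 11 1 [Node 0 6 [Node 4 0 [Node 11 7 [Node 13 1 [
Node 4 6 [Node 2 3 [Node 8 4 [Node 1 0 [Node 5 0 [Node 3 6 [Node 14 7 []]]]]]]]]]]]]]]]],
Node 10 7 [Node 0 7 [Node 6 0 [Node 8 6 [Node 0 3 [Node 8 7 [Node 11 1 [Node 4 0 [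
Node 10 0 [Node 6 7 [Node 0 2 [Node 8 1 [Node 11 0 [Node 10 2 [Node 7 0 [Node 10 3 [
Node 4 6 [Node 8 4 []]]]]]]]], Node 5 0 [Node 6 1 [Node 0 4 [Node 3 0 [Node 1 6 [
Node 14 7 [Node 4 6 [Node 11 0 [Node 7 0 []]]]]]]]]]]]]]]]], Node 9 6 [Node 6 6 [
Node 4 6 [Node 5 4 [Node 7 0 [Node 12 5 [Node 13 1 [Node 5 3 [Node 7 3 [Node 11 0 [
Node 8 7 [Node 6 7 [Node 0 7 [Node 10 0 [Node 6 1 []]]]]]]], Node 3 0 [Node 0 4 [
Node 1 2 [Node 11 1 [Node 8 7 [Node 0 3 [Node 6 0 [Node 2 5 [Node 2 3 [Node 8 6 [
Node 4 1 [Node 11 4 [Node 7 3 [Node 3 3 [Node 10 5 [Node 13 4 [Node 0 5 [Node 11 3 []]]]]]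
]]]]]]]]]]]]]]]], Node 5 4 [Node 5 0 [Node 8 4 [Node 10 0 [Node 14 7 [Node 0 4 [Node 6 1 [
Node 0 7 [Node 8 7 [Node 12 3 [Node 8 2 [Node 12 6 [Node 6 4 []]]]]]], Node 1 6 [
Node 3 0 []]]]]], Node 8 4 [Node 10 0 [Node 6 2 [Node 10 5 [Node 11 7 [Node 11 1 [
Node 10 3 [Node 0 6 [Node 0 3 [Node 6 0 []]]]]]]]]]]]], Node 10 5 [Node 8 4 [Node 0 1 [
Node 5 0 [Node 6 3 [Node 3 4 [Node 0 6 [Node 14 5 [Node 11 7 [Node 5 4 [Node 4 6 [
Node 1 2 [Node 14 7 [Node 14 3 [Node 3 6 [Node 5 6 [Node 9 4 []]]]]]]]]]]]]]]]]],
Node 5 0 [Node 7 0 [Node 10 0 [Node 6 7 [Node 11 1 [Node 3 0 [Node 13 1 [Node 11 0 [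
Node 10 1 [Node 6 2 [Node 0 5 [Node 8 4 [Node 10 5 []]]]]]]]]]]]]]]]], Node 6 3 [
Node 6 2 [Node 8 4 [Node 10 3 [Node 6 6 [Node 10 5 [Node 0 6 [Node 6 0 [Node 0 3 [
Node 2 5 [Node 2 3 [Node 8 6 [Node 11 4 [Node 4 3 [Node 0 5 [Node 1 0 [Node 11 1 [
Node 13 1 [Node 2 0 [Node 7 1 [Node 10 2 [Node 12 3 [Node 11 3 [Node 2 1 [Node 4 2 [
Node 0 4 [Node 14 3 [Node 3 0 [Node 5 4 [Node 1 6 [Node 9 6 [Node 5 0 []]]]]]]]]]]]]]]],
Node 11 1 [Node 4 0 [Node 10 2 [Node 8 1 [Node 0 2 [Node 11 3 [Node 2 2 [Node 3 2 [
Node 14 3 [Node 4 2 [Node 0 4 [Node 3 0 [Node 1 2 [Node 5 4 [Node 9 6 [Node 2 0 [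
Node 7 4 [Node 1 5 [Node 13 6 []]]]]]]]]]]]]], Node 6 7 [Node 6 4 [Node 10 6 [Node 2 1 [
Node 12 3 [Node 9 7 [Node 7 1 []]]]]]]]]]]]]]]]]]]]], Node 6 0 [Node 11 4 [Node 8 6 [
Node 0 3 []]]]]], Node 0 1 [Node 10 5 [Node 10 7 [Node 0 5 [Node 10 6 [Node 10 0 [
Node 6 7 []]]]]]]]], Node 0 1 [Node 5 0 [Node 2 5 [Node 6 0 [Node 8 6 [Node 0 3 [
Node 8 1 [Node 8 7 [Node 10 3 [Node 10 2 [Node 6 1 [Node 11 1 [Node 0 4 [Node 3 0 [
Node 4 2 [Node 6 6 [Node 11 2 [Node 1 6 [Node 13 3 [Node 2 1 []]]]]]]]]]]]]]], Node 8 1 [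
Node 10 7 [Node 0 5 [Node 6 6 [Node 10 5 []]]]]]], Node 6 0 [Node 12 4 [Node 10 1 [
Node 13 2 [Node 2 0 [Node 9 2 [Node 5 4 [Node 9 6 [Node 3 0 [Node 10 7 [Node 13 1 [
Node 10 6 [Node 12 3 [Node 0 6 [Node 8 1 []]]]]]]]]]]]]]]]]]], Node 12 4 [Node 10 1 [
Node 6 0 [Node 10 3 [Node 0 3 [Node 10 6 [Node 10 7 [Node 8 6 [Node 10 5 [Node 8 4 [
Node 11 4 [Node 5 0 [Node 8 7 [Node 8 1 [Node 13 5 [Node 6 7 [Node 0 4 [Node 12 1 [
Node 4 2 []]]]]]]]]]]]], Node 8 7 [Node 6 7 [Node 0 5 [Node 8 1 [Node 4 3 [Node 8 4 [
Node 10 0 [Node 10 2 [Node 10 5 [Node 10 7 [Node 11 1 [Node 6 6 [Node 2 0 [Node 7 1 [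
Node 2 3 [Node 9 6 [Node 11 7 [Node 9 7 [Node 5 0 [Node 2 1 [Node 1 6 []]]]]]]]]]]]]]]]]]]
, Node 2 2 [Node 8 4 [Node 0 1 [Node 12 6 [Node 10 0 [Node 13 4 [Node 11 1 [Node 8 6 [
Node 11 3 [Node 10 2 [Node 2 0 [Node 5 2 [Node 4 2 [Node 13 2 [Node 0 4 [Node 3 0 [
Node 1 2 [Node 5 4 [Node 14 3 []]]]]]]]]]]]]]]]], Node 0 1 [Node 5 0 [Node 12 6 [
Node 10 0 [Node 13 4 [Node 6 1 [Node 11 1 [Node 0 4 [Node 7 5 [Node 3 0 [Node 6 6 [
Node 11 2 [Node 4 3 [Node 1 6 [Node 2 1 []]]]]]]]]]]]]]]]]]]]], Node 8 2 [Node 8 4 [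
Node 10 2 [Node 0 1 [Node 5 0 [Node 8 7 [Node 0 3 [Node 0 4 [Node 11 1 [Node 4 2 [
Node 6 6 [Node 11 2 [Node 3 0 [Node 13 3 [Node 1 6 [Node 2 1 []]]]]]]]]]]]]]]]]],
Node 0 1 [Node 8 4 [Node 10 0 [Node 10 3 [Node 10 7 [Node 10 2 [Node 11 2 [Node 0 2 [
Node 0 3 [Node 8 1 [Node 11 1 [Node 0 5 [Node 8 6 [Node 11 3 [Node 4 0 [Node 13 4 [
Node 7 2 []]]]]]]]]]]]]]]]]]]]]]]]])"
  by code_simp

text \<open>The same two orbits at offset 2, with offset 5 now available as an edge; this triangle
  has two vertices in orbit 10.\<close>

lemma conflict_2:
  "conflict (add_pair 0 8 5 adj) (0, 0) (10, 7) (10, 0) [(8, 2)] (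
Node 8 7 [Node 0 7 [Node 8 4 [Node 10 1 [Node 0 1 [Node 6 2 [Node 10 3 [Node 12 1 [
Node 6 4 [Node 8 6 [Node 0 2 [Node 6 0 [Node 6 7 [Node 0 3 [Node 0 5 [Node 8 0 []]]]]]]]]]
]], Node 6 0 [Node 11 0 [Node 0 2 [Node 8 5 [Node 0 1 [Node 6 6 [Node 8 6 [Node 8 0 [
Node 0 3 []]]]], Node 10 6 [Node 6 7 [Node 8 1 [Node 8 6 [Node 10 2 [Node 8 3 []]]]]]]]]]]
], Node 6 1 [Node 8 4 [Node 6 2 [Node 10 3 [Node 10 1 [Node 0 4 [Node 6 0 [Node 8 0 [
Node 0 3 []]]]]], Node 10 3 [Node 10 1 [Node 6 4 [Node 0 4 [Node 8 0 [Node 6 6 [Node 0 1 [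
Node 8 6 [Node 0 3 [Node 6 0 []]]]]], Node 6 6 [Node 0 1 [Node 8 0 [Node 8 6 [Node 0 5 [
Node 8 1 []]]]]]]]]]]]]], Node 10 6 [Node 8 4 [Node 6 7 [Node 12 1 [Node 6 2 [Node 0 5 [
Node 10 5 [Node 11 6 []]]]], Node 8 1 [Node 6 2 [Node 0 5 [Node 10 3 [Node 12 1 [
Node 4 6 [Node 13 7 [Node 11 6 [Node 10 5 [Node 8 6 [Node 6 4 [Node 6 0 [Node 0 2 [
Node 10 1 [Node 10 2 [Node 11 3 [Node 13 4 [Node 0 3 [Node 2 2 [Node 6 5 []]], Node 0 3 [
Node 8 0 [Node 3 3 [Node 8 3 [Node 0 7 [Node 4 5 [Node 11 0 [Node 2 7 [Node 13 1 []]]]]]]]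
]]]]]]]]]]]], Node 11 7 [Node 13 7 [Node 0 6 [Node 11 6 [Node 6 0 [Node 10 5 [Node 2 7 [
Node 8 6 [Node 0 1 [Node 6 6 [Node 8 0 [Node 0 3 [Node 4 1 [Node 11 1 [Node 13 2 []]]]]]]]
]]]]]]]]]]], Node 10 3 [Node 10 1 [Node 10 2 [Node 11 1 [Node 0 3 [Node 8 0 [Node 8 3 [
Node 8 5 [Node 6 5 [Node 12 4 []]]]]]]]]]]]], Node 0 7 [Node 6 2 [Node 10 1 [Node 12 1 [
Node 6 0 [Node 8 3 [Node 0 6 [Node 6 5 [Node 6 1 [Node 10 5 [Node 11 7 [Node 12 4 [
Node 10 2 [Node 6 4 [Node 0 1 [Node 4 6 [Node 2 5 [Node 6 3 [Node 13 2 [Node 11 4 [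
Node 8 1 [Node 7 0 [Node 3 3 [Node 5 5 [Node 11 0 [Node 14 6 [Node 13 1 [Node 5 7 [
Node 2 7 [Node 9 1 []]]]]]]]]]]]]]]]]]]]]]]], Node 6 5 [Node 8 0 [Node 0 3 []]]]]]],
Node 10 3 [Node 10 1 [Node 6 4 [Node 0 2 [Node 8 6 [Node 6 0 [Node 10 5 [Node 0 3 [
Node 0 5 [Node 8 0 []]]]]]]]]]]]], Node 0 7 [Node 6 5 [Node 8 3 [Node 0 3 [Node 8 0 [
Node 10 1 [Node 6 2 [Node 10 2 [Node 8 4 [Node 10 3 []]]]]], Node 6 0 [Node 0 6 [
Node 8 6 [Node 10 1 [Node 8 1 [Node 0 2 [Node 0 1 [Node 6 4 [Node 11 0 [Node 8 5 [
Node 4 7 [Node 6 7 [Node 12 6 []]]]]]]]]]]]]]]]]]])"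
  by code_simp

text \<open>Orbits 0 and 8 are now joined at offsets 2 to 5. The new pair joins orbits 6 and 8 at
  offset 5, besides offsets 2 and 6 already present.\<close>

lemma conflict_3:
  "conflict (add_pair 0 8 2 (add_pair 0 8 5 adj)) (6, 0) (0, 6) (8, 2) [(8, 5)] (
Node 8 0 [Node 0 0 [Node 10 7 [Node 10 6 [Node 6 5 [Node 8 3 [Node 12 2 [Node 0 1 [
Node 6 6 [Node 8 6 [Node 10 1 [Node 0 2 [Node 6 2 [Node 6 7 [Node 8 7 [Node 12 1 [
Node 0 3 [Node 0 4 [Node 2 2 [Node 5 7 [Node 1 5 [Node 3 3 []], Node 4 1 [Node 13 5 [
Node 11 2 [Node 4 4 [Node 7 2 []]]]]]]]]]]]]]]]], Node 6 3 [Node 8 6 [Node 10 0 [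
Node 2 0 [Node 0 3 [Node 11 1 []]]]]]]]], Node 0 3 [Node 8 3 [Node 12 7 [Node 8 6 [
Node 8 7 [Node 0 7 [Node 10 0 [Node 6 1 [Node 0 4 [Node 10 2 [Node 6 6 [Node 6 3 [
Node 10 5 [Node 12 0 [Node 0 1 [Node 8 1 [Node 0 5 [Node 10 1 [Node 5 5 [Node 5 1 [
Node 4 7 [Node 2 5 [Node 13 0 [Node 11 6 [Node 1 7 [Node 3 5 []]]]]]]]]]]]]]]]]]]]]]]]]]]]
], Node 8 3 [Node 10 7 [Node 0 7 [Node 10 6 [Node 6 5 [Node 0 3 [Node 8 6 [Node 8 7 [
Node 8 1 [Node 3 2 [Node 10 0 [Node 6 1 [Node 10 2 [Node 12 0 [Node 6 3 [Node 0 1 [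
Node 12 5 [Node 10 1 [Node 5 6 [Node 9 0 []]]]]]]]]]]]]]]]]]]]], Node 10 1 [Node 0 1 [
Node 6 3 [Node 8 3 [Node 10 2 [Node 0 2 [Node 0 3 [Node 8 6 []]]]]], Node 6 3 [Node 12 2 [
Node 0 3 [Node 8 6 [Node 0 2 [Node 8 3 [Node 10 2 []]]], Node 8 6 [Node 10 7 [Node 10 6 [
Node 10 0 [Node 8 7 [Node 11 7 [Node 0 5 [Node 6 5 [Node 6 2 [Node 2 0 [Node 8 3 [
Node 8 4 [Node 11 1 [Node 0 7 [Node 0 0 [Node 11 6 [Node 1 5 [Node 3 3 [Node 14 6 [
Node 4 5 [Node 5 7 [Node 2 7 [Node 9 1 []]]]]]]]]]]]]]]]]]]]]]]]]]]]])"
  by code_simp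

text \<open>With the empty list only the triangle is precolored, so the tree refutes every
  4-coloring of the enlarged table.\<close>

lemma conflict_4:
  "conflict (add_pair 6 8 5 (add_pair 0 8 2 (add_pair 0 8 5 adj))) (0, 0) (6, 5) (8, 3) [] (
Node 8 2 [Node 8 7 [Node 0 5 [Node 8 5 [Node 8 0 [Node 0 1 [Node 6 1 [Node 8 6 [Node 0 2 [
Node 0 4 [Node 8 1 [Node 6 4 [Node 6 7 [Node 10 2 [Node 12 6 [Node 11 3 [Node 2 4 []]]]]]]
]]], Node 8 6 [Node 0 4 [Node 6 4 [Node 0 7 [Node 8 1 [Node 8 4 [Node 6 2 [Node 10 5 [
Node 12 1 [Node 11 6 [Node 2 7 []]]]]]]], Node 0 2 [Node 8 1 [Node 0 7 [Node 6 7 [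
Node 8 4 []]]]]]]]], Node 6 6 [Node 10 1 [Node 8 4 [Node 10 0 [Node 0 2 [Node 6 2 [
Node 10 7 [Node 10 2 [Node 12 1 [Node 11 6 [Node 10 3 [Node 2 7 [Node 6 4 []]]]]]]]]]]]]]
, Node 0 3 [Node 6 2 [Node 0 1 [Node 6 3 [Node 6 6 [Node 8 4 [Node 0 2 [Node 8 1 [
Node 6 7 []]]]]], Node 8 4 [Node 6 6 [Node 10 0 [Node 6 1 [Node 10 1 [Node 10 7 [
Node 11 1 [Node 0 7 [Node 6 0 [Node 10 6 [Node 11 6 [Node 4 5 [Node 2 3 [Node 11 2 [
Node 0 4 [Node 3 0 [Node 11 5 [Node 14 1 [Node 3 4 [Node 5 0 [Node 9 2 [Node 12 7 [
Node 5 4 [Node 2 0 [Node 13 2 []]]]]]]]]]]]]]]]]]]]]], Node 10 7 [Node 8 6 [Node 6 0 [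
Node 8 1 [Node 0 7 [Node 6 4 [Node 6 7 [Node 4 3 [Node 2 5 [Node 12 2 [Node 11 4 [
Node 2 3 [Node 10 3 [Node 10 2 [Node 10 4 [Node 11 2 [Node 0 4 [Node 6 1 [Node 11 1 [
Node 11 5 [Node 1 0 [Node 2 4 [Node 14 1 [Node 13 6 [Node 5 0 []]]]]]]]]]]]]]]]],
Node 2 1 [Node 11 0 [Node 0 2 [Node 4 7 [Node 2 5 [Node 7 1 [Node 11 1 [Node 4 0 [
Node 10 2 [Node 2 2 [Node 10 3 [Node 11 3 [Node 13 0 [Node 11 4 [Node 1 2 [Node 0 6 [
Node 7 6 [Node 4 4 []]]]]]]]]]]]]]]]]]]]]]]]]]]]]]]]], Node 8 0 [Node 10 4 [Node 10 6 [
Node 10 5 [Node 0 6 [Node 6 6 [Node 6 0 [Node 8 4 [Node 8 6 [Node 0 2 []]]]]]]]]]],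
Node 10 4 [Node 8 0 [Node 0 6 [Node 10 5 [Node 10 6 [Node 11 6 [Node 8 5 [Node 10 7 [
Node 6 1 [Node 0 7 [Node 10 0 [Node 8 1 [Node 0 1 [Node 0 4 [Node 8 6 []]]]]], Node 10 0 [
Node 10 1 [Node 0 1 [Node 0 2 [Node 8 6 [Node 6 7 [Node 0 4 [Node 8 1 []]]]]]]]]]]]]],
Node 10 6 [Node 10 5 [Node 6 6 [Node 11 6 [Node 8 4 [Node 6 2 [Node 10 3 [Node 12 1 [
Node 6 4 [Node 2 7 []]]]]]]]]]], Node 8 5 [Node 0 3 [Node 6 3 [Node 10 6 [Node 12 4 [
Node 10 5 [Node 10 7 [Node 11 6 [Node 8 6 [Node 6 0 [Node 6 4 [Node 8 1 [Node 2 5 [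
Node 0 7 [Node 11 4 [Node 13 7 [Node 4 3 [Node 2 1 [Node 11 0 [Node 0 2 [Node 3 6 [
Node 11 3 [Node 1 2 [Node 2 2 [Node 14 3 [Node 12 1 [Node 5 2 []]]]]]]]]]]]]]]]]]]]]]]]]]]
]]], Node 6 2 [Node 0 5 [Node 8 4 [Node 8 0 [Node 8 5 [Node 10 1 [Node 0 2 []]]]]],
Node 8 4 [Node 0 7 [Node 6 1 [Node 10 0 [Node 8 1 [Node 6 7 [Node 10 2 [Node 0 2 [
Node 0 5 [Node 12 6 [Node 11 3 [Node 2 4 []]]]]]]]]], Node 8 1 [Node 0 5 [Node 6 4 [
Node 8 6 [Node 0 1 [Node 6 6 [Node 8 0 [Node 0 3 [Node 2 7 [Node 4 1 [Node 12 6 [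
Node 12 0 [Node 6 7 [Node 2 1 [Node 8 5 [Node 4 7 [Node 6 0 [Node 2 3 [Node 2 5 [
Node 11 2 [Node 10 1 [Node 10 3 [Node 10 0 [Node 10 2 [Node 11 0 [Node 11 4 [Node 0 2 [
Node 0 6 [Node 11 3 [Node 3 2 [Node 11 7 [Node 2 2 [Node 1 6 [Node 13 4 [Node 14 7 [
Node 5 6 []]]]]]]]]]]]]]]]]]]]]]]]]]], Node 11 6 [Node 10 5 [Node 10 7 [Node 10 4 [
Node 6 0 [Node 8 5 [Node 4 3 [Node 2 1 [Node 11 0 [Node 0 2 [Node 4 7 [Node 11 3 [
Node 2 5 [Node 1 2 []]]]]]], Node 2 5 [Node 11 4 []]]]]]]]]]]]]]]]], Node 10 0 [Node 6 1 [
Node 10 7 [Node 0 4 [Node 10 6 [Node 8 6 [Node 6 7 [Node 11 5 [Node 0 1 [Node 12 0 [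
Node 8 5 [Node 2 6 [Node 6 3 []]]]]]]]]]]]]]]]]], Node 8 7 [Node 8 5 [Node 0 6 [Node 6 0 [
Node 8 0 [Node 0 3 []]], Node 0 3 [Node 6 0 [Node 6 1 [Node 0 7 [Node 8 6 [Node 0 4 [
Node 8 1 []]]], Node 8 6 [Node 0 4 [Node 6 4 [Node 0 7 [Node 8 1 [Node 10 3 [Node 8 4 [
Node 10 2 [Node 0 2 [Node 6 2 [Node 6 7 [Node 10 5 [Node 12 3 [Node 6 3 [Node 8 0 [
Node 10 4 [Node 10 6 [Node 11 4 [Node 2 4 [Node 11 5 [Node 11 3 [Node 13 6 [Node 0 5 [
Node 4 2 [Node 4 3 [Node 2 0 [Node 2 5 [Node 11 7 [Node 13 7 [Node 0 1 [Node 11 2 [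
Node 3 5 [Node 1 1 [Node 5 1 [Node 14 2 []]]]]]]]]]]]]]]]]]]]]]]]]]]]]]]], Node 0 2 [
Node 8 4 [Node 10 3 [Node 12 3 [Node 12 6 [Node 10 2 [Node 4 4 [Node 13 4 [Node 11 1 [
Node 2 2 []]]]]]]], Node 6 7 [Node 8 1 [Node 2 2 [Node 4 4 [Node 12 1 [Node 12 3 [
Node 6 2 [Node 2 4 [Node 2 7 [Node 8 0 [Node 6 3 [Node 2 6 [Node 11 5 [Node 13 0 [
Node 10 4 [Node 13 6 [Node 0 7 [Node 10 5 [Node 0 5 [Node 11 0 [Node 11 6 [Node 4 7 [
Node 7 6 [Node 2 1 [Node 12 0 []]]]]]]]]]]]]]]]]]]]]], Node 11 1 [Node 10 0 [Node 10 2 [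
Node 10 7 [Node 6 3 [Node 8 0 [Node 4 6 [Node 2 4 [Node 11 3 [Node 0 5 [Node 4 2 [
Node 11 6 [Node 2 0 [Node 1 5 []]]]]]], Node 2 0 [Node 11 7 []]]]]]]]]]]]]]]]]]],
Node 8 0 [Node 8 6 [Node 0 1 [Node 6 0 [Node 6 3 [Node 10 1 [Node 12 7 [Node 10 0 [
Node 2 0 [Node 11 7 []]]]]]]], Node 6 1 [Node 0 4 [Node 10 2 [Node 8 1 [Node 10 3 [
Node 6 3 [Node 8 4 [Node 0 2 [Node 6 2 [Node 6 7 [Node 4 6 [Node 2 4 [Node 11 3 [
Node 0 5 [Node 4 2 [Node 2 0 [Node 10 6 [Node 10 7 [Node 11 7 [Node 11 6 [Node 0 1 [
Node 1 5 [Node 11 2 [Node 14 6 [Node 3 1 [Node 5 5 [Node 9 7 [Node 13 3 [Node 7 1 []]]]]]]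
]]]]], Node 10 5 [Node 10 7 [Node 11 4 [Node 6 0 [Node 7 4 []]]]]]]]]]], Node 2 0 [
Node 12 5 [Node 11 7 [Node 2 6 [Node 10 0 [Node 10 6 [Node 10 1 [Node 10 5 [Node 11 5 [
Node 0 7 [Node 6 4 [Node 11 4 [Node 11 0 [Node 1 3 [Node 2 7 [Node 14 4 [Node 13 1 [
Node 5 3 []]]]]]]]]]]]]]]]]]]]]]]]]], Node 10 1 [Node 10 3 [Node 11 1 [Node 0 2 [
Node 10 4 [Node 11 4 [Node 4 0 [Node 6 3 [Node 2 6 [Node 11 5 [Node 0 7 [Node 3 3 [
Node 11 0 [Node 14 4 [Node 3 7 [Node 5 3 [Node 9 5 [Node 12 2 [Node 5 7 [Node 2 3 [
Node 13 5 []]]]]]]]]]]]]]]]]]]]]]]]]]]], Node 0 3 [Node 10 6 [Node 12 4 [Node 8 0 [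
Node 0 6 [Node 12 7 [Node 6 0 [Node 6 3 [Node 8 6 [Node 10 4 [Node 0 2 [Node 12 5 [
Node 10 5 [Node 13 3 [Node 5 5 []]]]]]]]]]], Node 0 5 [Node 0 6 [Node 6 2 [Node 6 0 [
Node 10 5 [Node 2 5 [Node 11 4 []]]]]]]]]]]], Node 0 5 [Node 10 4 [Node 6 2 [Node 8 0 [
Node 8 4 [Node 12 1 [Node 0 3 [Node 10 3 [Node 4 2 [Node 0 4 [Node 11 3 [Node 6 6 [
Node 2 2 [Node 10 7 [Node 13 4 [Node 6 0 [Node 3 3 [Node 12 2 [Node 1 5 [Node 5 0 [
Node 13 6 []]]]]]]]]]]], Node 11 3 [Node 0 2 [Node 6 4 [Node 10 1 [Node 8 6 [Node 12 6 [
Node 6 0 [Node 13 4 [Node 7 4 [Node 3 3 [Node 11 4 []]]]]]]]]]]]]]]]], Node 8 0 [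
Node 0 6 [Node 8 5 [Node 6 3 []]]]]], Node 6 2 [Node 8 0 [Node 8 4 [Node 0 3 [Node 6 6 [
Node 0 1 [Node 0 4 [Node 8 6 []]]]]]]]]]])"
  by code_simp

lemma not_proper4_adj: "\<not> proper4 adj c"
proof
  assume "proper4 adj c"
  from conflict_sound[OF conflict_4 this[THEN proper4_extend[OF conflict_1],
      THEN proper4_extend[OF conflict_2], THEN proper4_extend[OF conflict_3]]]
  show False by simp
qed

section \<open>Counting edges and transferring colorings\<close>

text \<open>Each fiber consists of \<open>(u, v)\<close> and \<open>(v, u)\<close>, which differ by
  irreflexivity.\<close>

lemma two_card_unordered_pairs:
  assumes "finite D" "sym D" "irrefl D"
  shows "2 * card ((\<lambda>(u, v). {u, v}) ` D) = card D"
proof -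
  let ?f = "\<lambda>(u, v). {u, v}"
  have "card {p \<in> D. ?f p = e} = 2" if "e \<in> ?f ` D" for e
  proof -
    from that obtain u v where uv: "(u, v) \<in> D" "e = {u, v}" by auto
    with assms(2,3) have "(v, u) \<in> D" "u \<noteq> v" by (auto simp: sym_def irrefl_def)
    then have "{p \<in> D. ?f p = e} = {(u, v), (v, u)}"
      using uv by (auto simp: doubleton_eq_iff)
    with \<open>u \<noteq> v\<close> show ?thesis by simp
  qed
  moreover have "card D = (\<Sum>e\<in>?f ` D. card {p \<in> D. ?f p = e})"
    using sum.image_gen[OF assms(1), of "\<lambda>_. 1::nat" ?f] by simp
  ultimately show ?thesis by simp
qed

lemma proper_coloring_mono: "proper_coloring G k f \<Longrightarrow> k \<le> m \<Longrightarrow> proper_coloring G m f"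
  by (auto simp: proper_coloring_def)

text \<open>A coloring with fewer than four colors is also one with four, so every number in the
  infimum is at least 5; the value \<open>\<infinity>\<close> is covered as well.\<close>

lemma five_le_chromatic_number:
  assumes "\<And>f. \<not> proper_coloring G 4 f"
  shows "5 \<le> chromatic_number G"
  unfolding chromatic_number_def
proof (rule Inf_greatest)
  fix x assume "x \<in> {enat k |k. \<exists>f. proper_coloring G k f}"
  then obtain k f where "x = enat k" "proper_coloring G k f" by auto
  with assms proper_coloring_mono[of G k f 4] show "5 \<le> x"
    by (cases "k \<le> 4") (auto simp: numeral_eq_enat)
qed

lemma mem_edges_difference_graph:
  "{u, v} \<in> edges (difference_graph V D) \<longleftrightarrow> u \<in> V \<and> v \<in> V \<and> (u - v \<in> D \<or> v - u \<in> D)"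
  by (auto simp: edges_def difference_graph_def doubleton_eq_iff)

text \<open>Complex multiplication by \<open>p / 4\<close>; it takes the octagon on which \<^const>\<open>W80\<close> lies, whose first
  vertex is \<open>(4, 0)\<close>, to the octagon with first vertex \<open>p\<close>.\<close>

definition similarity :: "real^2 \<Rightarrow> real^2 \<Rightarrow> real^2" where
  "similarity p w = vector [(w $ 1 * p $ 1 - w $ 2 * p $ 2) / 4, (w $ 1 * p $ 2 + w $ 2 * p $ 1) / 4]"

lemma similarity_diff: "similarity p (u - v) = similarity p u - similarity p v"
  by (simp add: similarity_def vec_eq_iff forall_2 algebra_simps
      diff_divide_distrib add_divide_distrib)

lemma similarity_rotation: "similarity p (rotation t w) = rotation t (similarity p w)"
  by (simp add: similarity_def rotation_def vec_eq_iff forall_2 algebra_simps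
      diff_divide_distrib add_divide_distrib)

section \<open>Identification of \<open>G120\<close> with the table\<close>

lemma S15_eq: "S15 = point ` set S_list"
  by (simp add: S15_def S_list_def)

lemma orbit_list_points:
  assumes "\<forall>q\<in>set qs. evenq q"
  shows "(\<Union>p\<in>point ` set qs. octagonal_orbit p) = point ` set (concat (map orbit_list qs))"
  using assms by (auto simp: octagonal_orbit_point)

lemma W80_eq: "W80 = point ` set W_list"
  unfolding W80_def W_list_def
  by (subst orbit_list_points[symmetric]) simp_all

lemma card_W80: "card W80 = 80"
  unfolding W80_eq
  by (simp add: card_image[OF inj_on_subset[OF inj_point]] distinct_card distinct_W)

lemma zero_notin_W80: "0 \<notin> W80"
proof
  assume "0 \<in> W80"
  then obtain q where q: "q \<in> set W_list" "0 = point q" by (auto simp: W80_eq)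
  moreover have "0 = point (0, 0, 0, 0)" by (simp add: vec_eq_iff forall_2)
  ultimately have "(0, 0, 0, 0) \<in> set W_list" using injD[OF inj_point] by metis
  with distinct_W(3) show False by contradiction
qed

lemma card_S15: "card S15 = 15"
proof -
  have "distinct S_list" "length S_list = 15" by (simp_all add: S_list_def)
  then show ?thesis
    unfolding S15_eq by (simp add: card_image[OF inj_on_subset[OF inj_point]] distinct_card)
qed

definition vert :: "nat \<times> nat \<Rightarrow> real^2" where
  "vert v = rot (snd v) (point (S_list ! fst v))"

abbreviation ix :: "(nat \<times> nat) set" where "ix \<equiv> {..<15} \<times> {..<8}"

lemma S_list_even: "i < 15 \<Longrightarrow> evenq (S_list ! i)"
proof -
  have "\<forall>q\<in>set S_list. evenq q" "length S_list = 15" by (simp_all add: S_list_def)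
  then show "i < 15 \<Longrightarrow> evenq (S_list ! i)" by simp
qed

lemma octagonal_orbit_lessThan: "octagonal_orbit p = (\<lambda>k. rot k p) ` {..<8}"
proof -
  have "{0..7::nat} = {..<8}" by auto
  then show ?thesis by (simp add: octagonal_orbit_def rot_def)
qed

lemma vertices_eq: "vertices G120 = vert ` ix"
proof -
  have "set S_list = (\<lambda>i. S_list ! i) ` {..<15}"
    by (simp add: set_conv_nth S_list_def image_def) auto
  then have "vertices G120 = (\<Union>i\<in>{..<15}. octagonal_orbit (point (S_list ! i)))"
    by (simp add: vertices_def G120_def difference_graph_def S15_eq)
  also have "\<dots> = vert ` ix"
    by (force simp: octagonal_orbit_lessThan vert_def)
  finally show ?thesis .
qed

lemma vertices_difference_graph: "vertices (difference_graph V D) = V"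
  by (simp add: vertices_def difference_graph_def)

lemma G120_eq: "G120 = difference_graph (vert ` ix) W80"
  using vertices_eq by (simp add: G120_def vertices_difference_graph)

lemma card_vertices: "card (vertices G120) = 120"
proof -
  have "vertices G120 = point ` set (concat (map orbit_list S_list))"
    unfolding G120_def vertices_def difference_graph_def fst_conv S15_eq
    by (rule orbit_list_points) (simp add: S_list_def)
  moreover have "length (concat (map orbit_list S_list)) = 120"
    by (simp add: S_list_def orbit_list_def)
  ultimately show ?thesis
    by (simp only: card_image[OF inj_on_subset[OF inj_point subset_UNIV]] distinct_card[OF distinct_V])
qed

text \<open>The map takes 120 indices onto 120 vertices, so it is injective by counting.\<close>

lemma inj_vert: "inj_on vert ix"
  by (rule eq_card_imp_inj_on) (simp_all add: vertices_eq[symmetric] card_vertices)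

lemma point_diffq: "point (diffq p q) = point p - point q"
  by (cases p; cases q) (simp add: vec_eq_iff forall_2 algebra_simps)

lemma diff_mem_W80_iff:
  assumes "i < 15" "j < 15" "k < 8"
  shows "point (S_list ! i) - rot k (point (S_list ! j)) \<in> W80 \<longleftrightarrow> (j, k) \<in> set (adj ! i)"
proof -
  have len: "length S_list = 15" by (simp add: S_list_def)
  have "point (S_list ! i) - rot k (point (S_list ! j)) =
      point (diffq (S_list ! i) ((rotq ^^ k) (S_list ! j)))"
    using point_rotq_pow[OF S_list_even[OF assms(2)]] by (simp add: point_diffq)
  also have "\<dots> \<in> W80 \<longleftrightarrow> diffq (S_list ! i) ((rotq ^^ k) (S_list ! j)) \<in> set W_list"
    unfolding W80_eq using inj_point by (simp add: inj_image_mem_iff)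
  also have "\<dots> \<longleftrightarrow> (j, k) \<in> set (adj ! i)"
    using assms len by (simp add: adj_eq[symmetric] adjacency_def orbit_list_def)
  finally show ?thesis .
qed

lemma adj_subset_ix: "i < 15 \<Longrightarrow> set (adj ! i) \<subseteq> ix"
  using adj_bounds by (fastforce dest: bspec[OF _ nth_mem])

text \<open>Rotating back by \<open>a\<close> brings the first vertex to position 0, where the table
  records which differences lie in \<open>W80\<close>.\<close>

lemma vert_diff_mem_W80_iff:
  assumes "(i, a) \<in> ix" "(j, b) \<in> ix"
  shows "vert (i, a) - vert (j, b) \<in> W80 \<longleftrightarrow> (j, b) \<in> set (nbrs adj i a)"
proof -
  \<comment> \<open>The offset is \<open>b - a\<close> modulo 8; adding 8 first keeps the natural
    subtraction from truncating.\<close>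
  define k where "k = (b + 8 - a) mod 8"
  have b: "b = (a + k) mod 8" using assms by (auto simp: k_def mod_simps)
  have unique: "m = k" if "b = (a + m) mod 8" "m < 8" for m
    using that assms(1) unfolding k_def by (cases "a + m < 8") (auto simp: mod_if)
  have "vert (i, a) - vert (j, b) = rot a (point (S_list ! i) - rot k (point (S_list ! j)))"
    by (simp add: vert_def b rot_mod rot_diff rot_add)
  also have "\<dots> \<in> W80 \<longleftrightarrow> (j, k) \<in> set (adj ! i)"
    using assms by (subst rot_in_W80_iff) (simp add: diff_mem_W80_iff k_def)
  also have "\<dots> \<longleftrightarrow> (j, b) \<in> set (nbrs adj i a)"
    using adj_subset_ix[of i] assms(1) b unique
    by (auto simp: nbrs_def image_iff intro!: bexI[of _ "(j, k)"])
  finally show ?thesis .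
qed

lemma uminus_mem_W80: "w \<in> W80 \<Longrightarrow> - w \<in> W80"
proof -
  have "rot 4 w = - w" by (simp add: rot_def vec_eq_iff forall_2)
  then show "w \<in> W80 \<Longrightarrow> - w \<in> W80" using rot_in_W80_iff[of 4 w] by simp
qed

lemma nbrs_subset_ix: "(i, a) \<in> ix \<Longrightarrow> set (nbrs adj i a) \<subseteq> ix"
  using adj_subset_ix[of i] by (auto simp: nbrs_def)

lemma card_edges: "card (edges G120) = 704"
proof -
  \<comment> \<open>\<open>D\<close> consists of the ordered adjacent pairs, two for each edge, and
    its size is the sum of the degrees.\<close>
  define D where "D = {(u, v). u \<in> vert ` ix \<and> v \<in> vert ` ix \<and> u - v \<in> W80}"
  have D: "D = Sigma (vert ` ix) (\<lambda>u. {v \<in> vert ` ix. u - v \<in> W80})" by (auto simp: D_def)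
  have "edges G120 = (\<lambda>(u, v). {u, v}) ` D"
    by (auto simp: D_def G120_eq edges_def difference_graph_def image_iff)
  moreover have "finite D" unfolding D by (intro finite_SigmaI) auto
  moreover have "sym D"
    using uminus_mem_W80 by (force simp: D_def sym_def)
  moreover have "irrefl D" using zero_notin_W80 by (auto simp: D_def irrefl_def)
  ultimately have "2 * card (edges G120) = card D" by (simp add: two_card_unordered_pairs)
  also have "card D = (\<Sum>u\<in>vert ` ix. card {v \<in> vert ` ix. u - v \<in> W80})"
    unfolding D by (rule card_SigmaI) auto
  also have "\<dots> = (\<Sum>u\<in>ix. card {v \<in> vert ` ix. vert u - v \<in> W80})"
    by (subst sum.reindex[OF inj_vert]) simp
  also have "\<dots> = (\<Sum>(i, a)\<in>ix. length (nbrs adj i a))"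
  proof (intro sum.cong refl)
    fix u assume u: "u \<in> ix"
    then obtain i a where ia: "u = (i, a)" "i < 15" "a < 8" by auto
    then have "{v \<in> vert ` ix. vert (i, a) - v \<in> W80} = vert ` set (nbrs adj i a)"
      using nbrs_subset_ix[of i a] by (auto simp: vert_diff_mem_W80_iff)
    moreover have "inj_on vert (set (nbrs adj i a))"
      using ia nbrs_subset_ix by (intro inj_on_subset[OF inj_vert]) simp
    moreover have "distinct (nbrs adj i a)" using nbrs_adj(1) ia by simp
    ultimately show "card {v \<in> vert ` ix. vert u - v \<in> W80} =
        (case u of (i, a) \<Rightarrow> length (nbrs adj i a))"
      by (simp add: ia(1) card_image distinct_card)
  qed
  also have "\<dots> = sum_list (map (\<lambda>(i, a). length (nbrs adj i a)) (List.product [0..<15] [0..<8]))"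
    by (subst sum_list_distinct_conv_sum_set) (simp_all add: distinct_product atLeast0LessThan)
  finally have "2 * card (edges G120) = 1408" using nbrs_adj(2) by simp
  then show ?thesis by simp
qed

lemma proper_coloring_G120_iff:
  "proper_coloring G120 k f \<longleftrightarrow>
     (\<forall>v\<in>ix. f (vert v) < k \<and> (\<forall>w\<in>set (nbrs adj (fst v) (snd v)). f (vert v) \<noteq> f (vert w)))"
proof -
  have adjacent: "{vert v, vert w} \<in> edges G120 \<longleftrightarrow> w \<in> set (nbrs adj (fst v) (snd v))"
    if "v \<in> ix" "w \<in> ix" for v w
  proof -
    have "vert w - vert v \<in> W80 \<longleftrightarrow> vert v - vert w \<in> W80"
      using uminus_mem_W80[of "vert w - vert v"] uminus_mem_W80[of "vert v - vert w"] by auto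
    then have "{vert v, vert w} \<in> edges G120 \<longleftrightarrow> vert v - vert w \<in> W80"
      using that by (simp add: G120_eq mem_edges_difference_graph)
    then show ?thesis
      using that vert_diff_mem_W80_iff[of "fst v" "snd v" "fst w" "snd w"] by simp
  qed
  have "(\<forall>w\<in>ix. {vert v, vert w} \<in> edges G120 \<longrightarrow> f (vert v) \<noteq> f (vert w)) \<longleftrightarrow>
      (\<forall>w\<in>set (nbrs adj (fst v) (snd v)). f (vert v) \<noteq> f (vert w))" if "v \<in> ix" for v
  proof -
    have "set (nbrs adj (fst v) (snd v)) \<subseteq> ix"
      using nbrs_subset_ix[of "fst v" "snd v"] that by simp
    with adjacent[OF that] show ?thesis by blast
  qed
  then show ?thesis
    unfolding proper_coloring_def vertices_eq by (simp add: ball_conj_distrib)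
qed

lemma not_proper_coloring_G120: "\<not> proper_coloring G120 4 f"
proof
  assume f: "proper_coloring G120 4 f"
  have "proper4 adj (\<lambda>i a. f (vert (i, a)))"
    unfolding proper4_def
  proof (intro conjI allI impI adj_bounds(1) ballI, goal_cases)
    case (1 i a)
    then show ?case using f unfolding proper_coloring_G120_iff by fastforce
  next
    case (2 i a w)
    then have "w \<in> ix" "f (vert (i, a)) \<noteq> f (vert w)"
      using f nbrs_subset_ix[of i a] unfolding proper_coloring_G120_iff by fastforce+
    then show ?case by (cases w) simp
  qed
  with not_proper4_adj show False by blast
qed

lemma proper_coloring_G120: "\<exists>f. proper_coloring G120 5 f"
proof
  define f where "f u = (let v = inv_into ix vert u in colors ! fst v ! snd v)" for u
  have f: "f (vert v) = colors ! fst v ! snd v" if "v \<in> ix" for v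
    using inv_into_f_f[OF inj_vert that] by (simp add: f_def)
  show "proper_coloring G120 5 f"
    unfolding proper_coloring_G120_iff
  proof
    fix v assume v: "v \<in> ix"
    obtain i a where ia: "v = (i, a)" "i < 15" "a < 8" using v by auto
    have "\<forall>w\<in>set (nbrs adj i a). f (vert w) = colors ! fst w ! snd w"
      using f nbrs_subset_ix[of i a] ia by blast
    then show "f (vert v) < 5 \<and> (\<forall>w\<in>set (nbrs adj (fst v) (snd v)). f (vert v) \<noteq> f (vert w))"
      using colors_adj ia f[OF v] by fastforce
  qed
qed

section \<open>Transfer to an arbitrary regular octagon\<close>

text \<open>Each vector is a rotation of a generator on the first side. The similarity commutes with
  rotations, so the image lies on the side starting at \<open>rot k p\<close>.\<close>

lemma W80_subset_octagon:
  assumes "p \<noteq> 0" "w \<in> W80"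
  shows "similarity p w \<in> frontier (convex hull (octagonal_orbit p))"
proof -
  let ?L = "[(0, 0), (0, 1), (-2, 2), (2, 0), (4, -2), (-4, 4), (-4, 3), (4, -1), (2, -1), (-2, 3)]"
  \<comment> \<open>All ten generators lie on the side from \<open>(4, 0)\<close> to its rotation by \<open>pi / 4\<close>, where
    the second coordinate \<open>c + d sqrt 2\<close> determines the point.\<close>
  have "W80 = (\<Union>(c, d)\<in>set ?L. octagonal_orbit (pt (4 - 2 * d + c) (d - c) c d))"
    by (simp add: W80_def)
  then obtain c d where cd: "(c, d) \<in> set ?L" "w \<in> octagonal_orbit (pt (4 - 2 * d + c) (d - c) c d)"
    using assms(2) by blast
  \<comment> \<open>Along the first side the second coordinate runs from 0 to
    \<open>2 * sqrt 2\<close>, so \<open>t\<close> is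
    \<open>(c + d * sqrt 2) / (2 * sqrt 2)\<close>.\<close>
  define t where "t = (of_int c * sqrt 2 + 2 * of_int d) / 4"
  obtain k where "w = rot k (pt (4 - 2 * d + c) (d - c) c d)"
    using cd(2) by (auto simp: octagonal_orbit_eq)
  moreover have "similarity p (pt (4 - 2 * d + c) (d - c) c d) = (1 - t) *\<^sub>R p + t *\<^sub>R rot 1 p"
    by (simp add: similarity_def t_def rot_def vec_eq_iff forall_2 cos_45 sin_45 field_simps)
  moreover have "rot 1 (rot k p) = rot k (rot 1 p)"
    by (simp only: rot_add[symmetric] add.commute)
  ultimately have "similarity p w = (1 - t) *\<^sub>R rot k p + t *\<^sub>R rot 1 (rot k p)"
    by (simp add: rot_def similarity_rotation)
      (simp add: vec_eq_iff forall_2 algebra_simps)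
  moreover have "0 \<le> t" "t \<le> 1"
  proof -
    \<comment> \<open>Every nonzero \<open>t\<close> among the ten lies between 0.08 and 0.92, so
      two decimals of \<open>sqrt 2\<close> suffice.\<close>
    have "1.41 \<le> sqrt 2" by (rule real_le_rsqrt) (simp add: power2_eq_square)
    moreover have "sqrt 2 \<le> 1.42" by (rule real_le_lsqrt) (simp_all add: power2_eq_square)
    ultimately show "0 \<le> t" "t \<le> 1" using cd(1) by (auto simp: t_def)
  qed
  moreover have "rot k p \<noteq> 0"
    using rot_inverse[of k p] assms(1) by (auto simp: rot_def rotation_def vec_eq_iff forall_2)
  ultimately show ?thesis
    using edge_subset_frontier[of "rot k p" t] by (simp add: octagonal_orbit_rot)
qed

lemma five_le_chromatic_number_octagon:
  assumes "regular_octagon C"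
  shows "5 \<le> chromatic_number (minkowski_plane_graph C)"
proof (rule five_le_chromatic_number)
  fix f
  obtain p where p: "p \<noteq> 0" "C = frontier (convex hull (octagonal_orbit p))"
    using assms by (auto simp: regular_octagon_def)
  show "\<not> proper_coloring (minkowski_plane_graph C) 4 f"
  proof
    assume "proper_coloring (minkowski_plane_graph C) 4 f"
    \<comment> \<open>Adjacent vertices differ by a vector of \<open>W80\<close>, which the
      similarity sends into \<open>C\<close>; as it preserves differences, their images are at
      distance 1.\<close>
    then have "proper_coloring G120 4 (f \<circ> similarity p)"
      using W80_subset_octagon[OF p(1)]
      unfolding proper_coloring_def G120_def minkowski_plane_graph_def p(2) vertices_difference_graph
      by (simp add: mem_edges_difference_graph) (metis similarity_diff)
    with not_proper_coloring_G120 show False by blast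
  qed
qed

theorem theorem2p1:
  shows "card W80 = 80 \<and> card S15 = 15 \<and>
         card (vertices G120) = 120 \<and>
         card (edges G120) = 704 \<and>
         chromatic_number G120 = 5 \<and>
         (\<forall>C. regular_octagon C \<longrightarrow> chromatic_number (minkowski_plane_graph C) \<ge> 5)"
proof -
  have "chromatic_number G120 \<le> 5"
    using proper_coloring_G120 unfolding chromatic_number_def
    by (auto simp: numeral_eq_enat intro!: Inf_lower)
  moreover have "5 \<le> chromatic_number G120"
    by (rule five_le_chromatic_number) (rule not_proper_coloring_G120)
  ultimately show ?thesis
    using card_W80 card_S15 card_vertices card_edges five_le_chromatic_number_octagon by simp
qed

end
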